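(* Let $m$ be a positive integer. The following relations among multiple zeta values hold. If $m$ is odd, then $$(m+2)\zeta(m+1)=2\sum_{\substack{i+2k=m\\ i,k\ge1}}\zeta(i+1)\zeta(2k),$$ $$(m+2)\zeta(m+1,1)=-\frac{\pi^2}{2}\zeta(m)+\frac{(m+2)(m+1)}{2}\zeta(m+2)-\sum_{\substack{i+2k=m\\ i,k\ge1}}(i+1)\zeta(i+2)\zeta(2k)-\sum_{\substack{i+j+2k=m\\ i,j,k\ge1}}(i+1)\zeta(i+1)\zeta(j+1)\zeta(2k).$$ If $m$ is even, then $$2\zeta(m,1)=m\,\zeta(m+1)-2\sum_{\substack{i+2k=m\\ i,k\ge1}}\zeta(i+1)\zeta(2k),$$ $$2\zeta(m,1,1)=-m\,\zeta(m+1,1)+\frac{\pi^2}{2}\zeta(m)-\frac{(m+2)(m+1)}{2}\zeta(m+2)+\sum_{\substack{i+2k=m\\ i,k\ge1}}(i+1)\zeta(i+2)\zeta(2k)+\sum_{\substack{i+j+2k=m\\ i,j,k\ge1}}(i+1)\zeta(i+1)\zeta(j+1)\zeta(2k).$$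
   Context: For integers $k_1\ge2$, $k_2,\dots,k_r\ge1$ the multiple zeta value is $\zeta(k_1,\dots,k_r)=\sum_{m_1>m_2>\cdots>m_r>0}\frac{1}{m_1^{k_1}\cdots m_r^{k_r}}$. The summation indices $i,j,k$ are integers; empty sums are $0$.
   Formalization: The case m=1 is excluded (there 3ζ(2)=0 is false and ζ(1) diverges); the factor (i+1) is dropped from both triple sums (the printed form fails at m=5); the fourth formula has +mζ(m+1,1) in place of −mζ(m+1,1) (the printed form fails at m=2). *)

theory Defs
  imports "HOL-Analysis.Analysis"
begin

definition mzv_indices :: "nat \<Rightarrow> nat list set" where
  "mzv_indices r = {ms. length ms = r \<and> sorted_wrt (>) ms \<and> (\<forall>n\<in>set ms. 0 < n)}"

(* All terms are nonnegative, so the unordered sum agrees with the usual multiple series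
   whenever that converges, i.e. whenever the leading exponent is at least 2 and the others
   are at least 1. For a divergent series infsum returns 0; such values carry no meaning. *)
definition mzv :: "nat list \<Rightarrow> real" where
  "mzv ks = (\<Sum>\<^sub>\<infinity>ms\<in>mzv_indices (length ks). \<Prod>l<length ks. 1 / real (ms ! l) ^ (ks ! l))"

end

theory Submission
  imports Defs "HOL-Real_Asymp.Real_Asymp"
begin

text \<open>
  Let \<open>P\<close>, \<open>Q\<close>, \<open>R\<close> be the generating series of the values at \<open>(n + 1)\<close>, \<open>(n + 1, 1)\<close>,
  \<open>(n + 1, 1, 1)\<close>. Up to sign they are sums \<open>g(a)\<close> over simple poles at the negative integers,
  evaluated at \<open>a = - x\<close>, and summation by parts gives
  \<open>g\<^sub>j(a + 1) - g\<^sub>j(a) = g\<^bsub>j-1\<^esub>(a + 1) / (a + 1)\<close>. The same recursion holds for polynomials in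
  polygamma functions at \<open>a + 1\<close>; since both sides are monotone and vanish at \<open>0\<close> and their
  unit differences tend to \<open>0\<close>, they coincide. Hence \<open>2 Q = P' - \<zeta>(2) - P\<^sup>2\<close> and
  \<open>6 R = P\<^sup>3 + 3 P (\<zeta>(2) - P') + P'' - 2 \<zeta>(3)\<close>. The reflection formula for the digamma function
  yields a Riccati equation for the odd part of \<open>P\<close>, which carries the even zeta values. The four
  relations are the coefficients of combinations of these identities in which every term not
  cancelled by the Riccati equation has degree at most \<open>1\<close> or the wrong parity.
\<close>

subsection \<open>Pole sums and their power series\<close>

text \<open>Equal unit differences make \<open>f - g\<close> 1-periodic, so \<open>f\<close> and
  \<open>g\<close> agree at all natural numbers, and \<open>f a - g a\<close> can be computed at
  \<open>a + n\<close>. There monotonicity traps both values between those of \<open>f\<close> at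
  two consecutive integers, and that gap tends to 0. This replaces an analytic uniqueness
  argument.\<close>

lemma monotone_eq_if_differences_vanish:
  fixes f g :: "real \<Rightarrow> real"
  assumes mono_f: "\<And>x y. 0 \<le> x \<Longrightarrow> x \<le> y \<Longrightarrow> f x \<le> f y"
    and mono_g: "\<And>x y. 0 \<le> x \<Longrightarrow> x \<le> y \<Longrightarrow> g x \<le> g y"
    and zero: "f 0 = g 0"
    and step: "\<And>x. 0 \<le> x \<Longrightarrow> f (x + 1) - f x = g (x + 1) - g x"
    and vanish: "(\<lambda>n. f (real n + 1) - f (real n)) \<longlonglongrightarrow> 0"
    and a: "0 \<le> a"
  shows "f a = g a"
proof -
  have shift: "f (x + real n) - g (x + real n) = f x - g x" if "0 \<le> x" for x n
  proof (induction n)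
    case (Suc n)
    have "f (x + real n + 1) - f (x + real n) = g (x + real n + 1) - g (x + real n)"
      using that by (intro step) simp
    with Suc show ?case by (simp add: algebra_simps)
  qed simp
  have int: "f (real n) = g (real n)" for n
    using shift[of 0 n] zero by simp
  define m where "m = nat \<lfloor>a\<rfloor>"
  have m: "real m \<le> a" "a \<le> real m + 1"
    using a by (simp_all add: m_def)
  have bound: "norm (f a - g a) \<le> f (real (n + m) + 1) - f (real (n + m))" for n
  proof -
    have "f (real (n + m)) \<le> f (a + real n)" "f (a + real n) \<le> f (real (n + m) + 1)"
         "g (real (n + m)) \<le> g (a + real n)" "g (a + real n) \<le> g (real (n + m) + 1)"
      using a m by (auto intro!: mono_f mono_g)
    moreover have "g (real (n + m) + 1) = f (real (n + m) + 1)"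
      using int[of "Suc (n + m)"] by (simp add: add_ac)
    ultimately have "\<bar>f (a + real n) - g (a + real n)\<bar> \<le> f (real (n + m) + 1) - f (real (n + m))"
      using int[of "n + m"] by linarith
    thus ?thesis using shift[OF a, of n] by simp
  qed
  have "(\<lambda>n. f a - g a) \<longlonglongrightarrow> 0"
    by (rule Lim_null_comparison[OF _ LIMSEQ_ignore_initial_segment[OF vanish, of m]])
       (use bound in auto)
  thus ?thesis by (simp add: LIMSEQ_const_iff)
qed

text \<open>At \<open>a = - x\<close> this is minus the power series in \<open>x\<close> whose coefficient of
  \<open>x ^ (s - 1)\<close> is \<open>\<Sum>k. c k / (k + 1) ^ s\<close>, for \<open>s \<ge> 2\<close>.\<close>
definition pole_sum :: "(nat \<Rightarrow> real) \<Rightarrow> real \<Rightarrow> real" where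
  "pole_sum c a = (\<Sum>k. c k * a / (real (Suc k) * (real (Suc k) + a)))"

lemma pole_sum_0 [simp]: "pole_sum c 0 = 0"
  by (simp add: pole_sum_def)

context
  fixes c :: "nat \<Rightarrow> real"
  assumes nonneg: "\<And>k. 0 \<le> c k"
    and summable: "summable (\<lambda>k. c k / real (Suc k) ^ 2)"
begin

lemma summable_pole_sum:
  assumes "0 \<le> a"
  shows "summable (\<lambda>k. c k * a / (real (Suc k) * (real (Suc k) + a)))"
proof (rule summable_comparison_test')
  show "summable (\<lambda>k. a * (c k / real (Suc k) ^ 2))"
    by (intro summable_mult summable)
next
  fix k :: nat
  have "a * c k / (real (Suc k) * (real (Suc k) + a)) \<le> a * c k / (real (Suc k) * real (Suc k))"
    using assms nonneg[of k] by (intro divide_left_mono mult_left_mono mult_pos_pos mult_nonneg_nonneg) auto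
  thus "norm (c k * a / (real (Suc k) * (real (Suc k) + a))) \<le> a * (c k / real (Suc k) ^ 2)"
    using assms nonneg[of k] by (simp add: power2_eq_square mult_ac abs_mult)
qed

lemma pole_sum_mono:
  assumes "0 \<le> a" "a \<le> b"
  shows "pole_sum c a \<le> pole_sum c b"
  unfolding pole_sum_def
proof (rule suminf_le)
  fix k
  have "a / (real (Suc k) + a) \<le> b / (real (Suc k) + b)"
    using assms mult_right_mono[OF assms(2) of_nat_0_le_iff[of k]]
    by (simp add: divide_simps) (simp add: algebra_simps)
  hence "c k / real (Suc k) * (a / (real (Suc k) + a)) \<le> c k / real (Suc k) * (b / (real (Suc k) + b))"
    using nonneg[of k] by (intro mult_left_mono) auto
  thus "c k * a / (real (Suc k) * (real (Suc k) + a)) \<le> c k * b / (real (Suc k) * (real (Suc k) + b))"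
    by simp
qed (use assms in \<open>simp_all add: summable_pole_sum del: of_nat_Suc\<close>)

text \<open>Dividing by \<open>a = n + 1\<close> cancels the numerator, so each term tends to 0
  under the summable bound \<open>c k / (k + 1)^2\<close>, and Tannery's theorem applies. By the
  recursions below, these quotients are the unit differences that have to vanish in
  \<open>monotone_eq_if_differences_vanish\<close>.\<close>

lemma pole_sum_over_nat_tendsto_0:
  "(\<lambda>n. pole_sum c (real n + 1) / (real n + 1)) \<longlonglongrightarrow> 0"
proof -
  have "(\<lambda>n. \<Sum>k. c k / (real (Suc k) * (real (Suc k) + (real n + 1)))) \<longlonglongrightarrow> (\<Sum>k. (0::real))"
  proof (rule tannerys_theorem[THEN conjunct2, THEN conjunct2])
    show "(\<lambda>n. c k / (real (Suc k) * (real (Suc k) + (real n + 1)))) \<longlonglongrightarrow> 0" for k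
      by real_asymp
    have "norm (c k / (real (Suc k) * (real (Suc k) + (real n + 1)))) \<le> c k / real (Suc k) ^ 2" for k n
      using nonneg[of k] by (auto simp: power2_eq_square abs_mult intro!: divide_left_mono mult_left_mono mult_pos_pos)
    thus "\<forall>\<^sub>F (k, n) in sequentially \<times>\<^sub>F sequentially.
            norm (c k / (real (Suc k) * (real (Suc k) + (real n + 1)))) \<le> c k / real (Suc k) ^ 2"
      by (auto simp: case_prod_unfold)
  qed (simp_all add: summable del: of_nat_Suc)
  also have "(\<lambda>n. \<Sum>k. c k / (real (Suc k) * (real (Suc k) + (real n + 1)))) =
               (\<lambda>n. pole_sum c (real n + 1) / (real n + 1))"
  proof
    fix n :: nat
    have "pole_sum c (real n + 1) =
            (\<Sum>k. (real n + 1) * (c k / (real (Suc k) * (real (Suc k) + (real n + 1)))))"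
      unfolding pole_sum_def by (simp add: mult_ac)
    also have "\<dots> = (real n + 1) * (\<Sum>k. c k / (real (Suc k) * (real (Suc k) + (real n + 1))))"
    proof (rule suminf_mult)
      have "summable (\<lambda>k. (c k * (real n + 1) / (real (Suc k) * (real (Suc k) + (real n + 1)))) / (real n + 1))"
        by (rule summable_divide, rule summable_pole_sum) simp
      thus "summable (\<lambda>k. c k / (real (Suc k) * (real (Suc k) + (real n + 1))))"
        by simp
    qed
    finally show "(\<Sum>k. c k / (real (Suc k) * (real (Suc k) + (real n + 1)))) =
        pole_sum c (real n + 1) / (real n + 1)" by (simp add: field_simps)
  qed
  finally show ?thesis by simp
qed

text \<open>Summation by parts turns the difference in \<open>a\<close> into the forward difference of the weights.\<close>
lemma pole_sum_plus_1:
  assumes small: "(\<lambda>k. c k / real (Suc k)) \<longlonglongrightarrow> 0" and a: "0 \<le> a"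
  shows "pole_sum c (a + 1) - pole_sum c a =
           c 0 / (a + 1) + (\<Sum>k. (c (Suc k) - c k) / (real (Suc k) + (a + 1)))"
proof -
  \<comment> \<open>By partial fractions the difference of the k-th terms is
    \<open>F k - c k / (k + 2 + a)\<close>. Adding the telescoping \<open>F (Suc k) - F k\<close>
    puts \<open>c (Suc k)\<close> and \<open>c k\<close> over the same denominator; the boundary
    value \<open>- F 0\<close> produces the term \<open>c 0 / (a + 1)\<close>.\<close>
  define F where "F k = c k / (real (Suc k) + a)" for k
  have lim: "F \<longlonglongrightarrow> 0"
  proof (rule Lim_null_comparison[OF _ small])
    show "\<forall>\<^sub>F k in sequentially. norm (F k) \<le> c k / real (Suc k)"
      using a nonneg by (auto simp: F_def intro!: always_eventually divide_left_mono)
  qed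
  have 1: "(\<lambda>k. c k * (a + 1) / (real (Suc k) * (real (Suc k) + (a + 1))) -
                c k * a / (real (Suc k) * (real (Suc k) + a))) sums (pole_sum c (a + 1) - pole_sum c a)"
    using a unfolding pole_sum_def by (intro sums_diff summable_sums summable_pole_sum) auto
  have 2: "(\<lambda>k. F (Suc k) - F k) sums (0 - F 0)"
    by (rule telescope_sums[OF lim])
  have "(\<lambda>k. (c (Suc k) - c k) / (real (Suc k) + (a + 1))) sums
          (pole_sum c (a + 1) - pole_sum c a + (0 - F 0))"
    using sums_add[OF 1 2]
  proof (rule sums_cong[THEN iffD1, rotated])
    fix k :: nat
    have "c k * (a + 1) / (real (Suc k) * (real (Suc k) + (a + 1))) -
          c k * a / (real (Suc k) * (real (Suc k) + a)) = c k / (real (Suc k) + a) - c k / (real (Suc k) + (a + 1))"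
      using a by (simp add: divide_simps add_pos_nonneg add_nonneg_eq_0_iff del: of_nat_Suc) (simp add: algebra_simps)
    thus "c k * (a + 1) / (real (Suc k) * (real (Suc k) + (a + 1))) -
          c k * a / (real (Suc k) * (real (Suc k) + a)) + (F (Suc k) - F k) =
          (c (Suc k) - c k) / (real (Suc k) + (a + 1))"
      by (simp add: F_def diff_divide_distrib add_ac)
  qed
  thus ?thesis by (simp add: sums_iff F_def)
qed

end

text \<open>Degree n carries exponent n + 1. The constant coefficient is set to 0 because exponent 1
  diverges already for constant weight 1; this matches the vanishing of \<open>pole_sum\<close> at
  0.\<close>

definition pole_series :: "(nat \<Rightarrow> real) \<Rightarrow> real fps" where
  "pole_series c = Abs_fps (\<lambda>n. if n = 0 then 0 else (\<Sum>k. c k / real (Suc k) ^ (n + 1)))"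

text \<open>Each pole term is expanded as a geometric series in \<open>x / (k + 1)\<close>, and the
  resulting double series is absolutely convergent, so it may be summed over k first. In
  \<open>f\<close> the index j stands for degree \<open>Suc j\<close>.\<close>

lemma pole_series_sums:
  fixes c :: "nat \<Rightarrow> real"
  assumes nonneg: "\<And>k. 0 \<le> c k"
    and summable: "summable (\<lambda>k. c k / real (Suc k) ^ 2)"
    and x: "\<bar>x\<bar> < 1"
  shows "(\<lambda>n. fps_nth (pole_series c) n * x ^ n) sums (- pole_sum c (- x))"
proof -
  define f where "f = (\<lambda>y (k, j). c k * y ^ Suc j / real (Suc k) ^ (j + 2))"
  define g where "g y k = c k * y / (real (Suc k) * (real (Suc k) - y))" for y k
  have small: "\<bar>y / real (Suc k)\<bar> < 1" if "\<bar>y\<bar> < 1" for y k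
    using that by (simp add: abs_mult)
  have inner_sums: "(\<lambda>j. f y (k, j)) sums g y k" if y: "\<bar>y\<bar> < 1" for y k
  proof -
    have "(\<lambda>j. c k * y / real (Suc k) ^ 2 * (y / real (Suc k)) ^ j) sums
            (c k * y / real (Suc k) ^ 2 * (1 / (1 - y / real (Suc k))))"
      using small[OF y, of k] by (intro sums_mult geometric_sums) simp
    also have "c k * y / real (Suc k) ^ 2 * (1 / (1 - y / real (Suc k))) = g y k"
      unfolding g_def power2_eq_square using y
      by (simp add: divide_simps del: of_nat_Suc)
    also have "(\<lambda>j. c k * y / real (Suc k) ^ 2 * (y / real (Suc k)) ^ j) = (\<lambda>j. f y (k, j))"
      by (simp add: f_def power_divide power_add mult_ac power2_eq_square del: of_nat_Suc)
    finally show ?thesis .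
  qed
  \<comment> \<open>Since the weights are nonnegative, absolute convergence at y is convergence at
    \<open>\<bar>y\<bar>\<close>, where all terms are nonnegative.\<close>
  have norm_f: "norm (f y p) = f \<bar>y\<bar> p" for y p
    using nonneg by (cases p) (simp add: f_def abs_mult power_abs del: of_nat_Suc power_Suc)
  have inner: "((\<lambda>j. f y (k, j)) has_sum g y k) UNIV" if y: "\<bar>y\<bar> < 1" for y k
  proof (rule norm_summable_imp_has_sum[OF _ inner_sums[OF y]])
    show "Series.summable (\<lambda>n. norm (f y (k, n)))"
      unfolding norm_f using inner_sums[of "\<bar>y\<bar>" k] y by (simp add: sums_iff)
  qed
  have g_summable: "Series.summable (\<lambda>k. norm (g y k))" if y: "\<bar>y\<bar> < 1" for y
  proof (rule summable_comparison_test')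
    show "Series.summable (\<lambda>k. \<bar>y\<bar> / (1 - \<bar>y\<bar>) * (c k / real (Suc k) ^ 2))"
      by (intro summable_mult summable)
    fix k :: nat
    \<comment> \<open>Keeps y away from every pole, at the cost of a constant factor
      \<open>1 / (1 - \<bar>y\<bar>)\<close> in the comparison with
      \<open>c k / (k + 1)^2\<close>.\<close>
    have "(1 - \<bar>y\<bar>) * real (Suc k) \<le> \<bar>real (Suc k) - y\<bar>"
    proof -
      have "(1 - \<bar>y\<bar>) * real (Suc k) = real (Suc k) - \<bar>y\<bar> - \<bar>y\<bar> * real k"
        by (simp add: algebra_simps)
      moreover have "0 \<le> \<bar>y\<bar> * real k" by simp
      ultimately show ?thesis by linarith
    qed
    hence "\<bar>y\<bar> * c k / (real (Suc k) * \<bar>real (Suc k) - y\<bar>) \<le> \<bar>y\<bar> * c k / (real (Suc k) * ((1 - \<bar>y\<bar>) * real (Suc k)))"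
      using y nonneg[of k] by (intro divide_left_mono mult_left_mono mult_pos_pos mult_nonneg_nonneg) auto
    thus "norm (norm (g y k)) \<le> \<bar>y\<bar> / (1 - \<bar>y\<bar>) * (c k / real (Suc k) ^ 2)"
      using nonneg[of k] by (simp add: g_def abs_mult power2_eq_square mult_ac)
  qed
  have "(\<lambda>p. norm (f x p)) summable_on UNIV \<times> UNIV"
    unfolding norm_f
  proof (rule summable_on_SigmaI)
    show "((\<lambda>j. f \<bar>x\<bar> (k, j)) has_sum g \<bar>x\<bar> k) UNIV" for k
      using inner[of "\<bar>x\<bar>" k] x by simp
    show "g \<bar>x\<bar> summable_on UNIV"
      using g_summable[of "\<bar>x\<bar>"] x by (intro norm_summable_imp_summable_on) simp
    show "0 \<le> f \<bar>x\<bar> (k, j)" for k j using nonneg[of k] by (simp add: f_def)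
  qed
  hence f_summable: "f x summable_on UNIV \<times> UNIV"
    by (rule abs_summable_summable)
  have "(g x has_sum (\<Sum>k. g x k)) UNIV"
    by (rule norm_summable_imp_has_sum) (use g_summable[OF x] summable_norm_cancel in blast)+
  moreover have "(\<Sum>k. g x k) = - pole_sum c (- x)"
  proof -
    have "Series.summable (g x)" using g_summable[OF x] by (rule summable_norm_cancel)
    from suminf_minus[OF this] show ?thesis by (simp add: pole_sum_def g_def)
  qed
  ultimately have "(f x has_sum (- pole_sum c (- x))) (UNIV \<times> UNIV)"
    using inner[OF x] f_summable by (intro has_sum_SigmaI[where g = "g x"]) auto
  hence swapped: "((\<lambda>(j, k). f x (k, j)) has_sum (- pole_sum c (- x))) (UNIV \<times> UNIV)"
    by (subst (asm) has_sum_swap)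
  have Z: "((\<lambda>k. f x (k, j)) has_sum fps_nth (pole_series c) (Suc j) * x ^ Suc j) UNIV" for j
  proof (rule norm_summable_imp_has_sum)
    have *: "Series.summable (\<lambda>k. c k / real (Suc k) ^ (j + 2))"
    proof (rule summable_comparison_test'[OF summable])
      fix k :: nat
      show "norm (c k / real (Suc k) ^ (j + 2)) \<le> c k / real (Suc k) ^ 2"
        using nonneg[of k] by (auto intro!: divide_left_mono power_increasing simp del: power_Suc of_nat_Suc)
    qed
    show "Series.summable (\<lambda>k. norm (f x (k, j)))"
      unfolding norm_f using summable_mult[OF *, of "\<bar>x\<bar> ^ Suc j"] by (simp add: f_def mult_ac)
    show "(\<lambda>k. f x (k, j)) sums (fps_nth (pole_series c) (Suc j) * x ^ Suc j)"
      using sums_mult[OF summable_sums[OF *], of "x ^ Suc j"]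
      by (simp add: f_def pole_series_def mult_ac)
  qed
  have "((\<lambda>j. fps_nth (pole_series c) (Suc j) * x ^ Suc j) has_sum (- pole_sum c (- x))) UNIV"
    by (rule has_sum_SigmaD[OF swapped]) (use Z in simp)
  hence "(\<lambda>j. fps_nth (pole_series c) (Suc j) * x ^ Suc j) sums (- pole_sum c (- x))"
    by (rule has_sum_imp_sums)
  \<comment> \<open>Puts back the zero coefficient of degree 0.\<close>
  from sums_Suc[OF this] show ?thesis by (simp add: pole_series_def)
qed

lemma
  fixes c :: "nat \<Rightarrow> real"
  assumes nonneg: "\<And>k. 0 \<le> c k"
    and summable: "summable (\<lambda>k. c k / real (Suc k) ^ 2)"
  shows fps_conv_radius_pole_series: "1 \<le> fps_conv_radius (pole_series c)"
    and eval_pole_series: "\<bar>x\<bar> < 1 \<Longrightarrow> eval_fps (pole_series c) x = - pole_sum c (- x)"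
proof -
  show "1 \<le> fps_conv_radius (pole_series c)"
    unfolding fps_conv_radius_def
  proof (rule conv_radius_geI_ex)
    fix r :: real assume r: "0 < r" "ereal r < 1"
    thus "\<exists>z. norm z = r \<and> Series.summable (\<lambda>n. fps_nth (pole_series c) n * z ^ n)"
      using pole_series_sums[OF assms, of r] by (intro exI[of _ r]) (auto simp: sums_iff)
  qed
  show "\<bar>x\<bar> < 1 \<Longrightarrow> eval_fps (pole_series c) x = - pole_sum c (- x)"
    using pole_series_sums[OF assms, of x] by (simp add: eval_fps_def sums_iff)
qed

subsection \<open>Weighted harmonic sums as polygamma polynomials\<close>

text \<open>The second elementary symmetric polynomial in \<open>1, 1/2, \<dots>, 1/k\<close>.\<close>
definition esym2_harm :: "nat \<Rightarrow> real" where
  "esym2_harm k = (\<Sum>j<k. harm j / real (Suc j))"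

lemma esym2_harm_0 [simp]: "esym2_harm 0 = 0"
  by (simp add: esym2_harm_def)

lemma esym2_harm_Suc: "esym2_harm (Suc k) = esym2_harm k + harm k / real (Suc k)"
  by (simp add: esym2_harm_def)

lemma esym2_harm_nonneg: "0 \<le> esym2_harm k"
  by (simp add: esym2_harm_def sum_nonneg harm_nonneg)

text \<open>The square of 1 + 1/2 + ... + 1/k contains each mixed product twice. This crude bound
  gives logarithmic-square growth, enough for \<open>weight_bounds\<close>.\<close>

lemma esym2_harm_le: "esym2_harm k \<le> (harm k)\<^sup>2"
proof (induction k)
  case (Suc k)
  have "0 \<le> harm k / real (Suc k)" by (simp add: harm_nonneg)
  moreover have "esym2_harm (Suc k) = esym2_harm k + harm k / real (Suc k)"
    by (rule esym2_harm_Suc)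
  ultimately have "esym2_harm (Suc k) \<le> (harm k)\<^sup>2 + 2 * (harm k / real (Suc k)) + (1 / real (Suc k))\<^sup>2"
    using Suc zero_le_power2[of "1 / real (Suc k)"] by linarith
  also have "\<dots> = (harm (Suc k))\<^sup>2"
    by (simp add: harm_Suc power2_sum inverse_eq_divide)
  finally show ?case .
qed simp

lemma harm_le_1_plus_ln: "harm k \<le> 1 + ln (real (Suc k))"
proof -
  have "harm (Suc k) - ln (real (Suc k)) \<le> harm (Suc 0) - ln (real (Suc 0))"
    by (rule decseqD[OF decseq_harm_diff_ln]) simp
  moreover have "harm k \<le> (harm (Suc k) :: real)" by (rule harm_mono) simp
  moreover have "harm (Suc 0) = (1 :: real)" by (simp add: harm_def)
  ultimately show ?thesis by simp
qed

text \<open>Supplies the two conditions of \<open>pole_sum_plus_1\<close>. A squared logarithm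
  dominates both \<open>harm\<close> and \<open>esym2_harm\<close>.\<close>

lemma weight_bounds:
  fixes c :: "nat \<Rightarrow> real"
  assumes nonneg: "\<And>k. 0 \<le> c k" and le: "\<And>k. c k \<le> (1 + ln (real (Suc k)))\<^sup>2"
  shows "summable (\<lambda>k. c k / real (Suc k) ^ 2)" and "(\<lambda>k. c k / real (Suc k)) \<longlonglongrightarrow> 0"
proof -
  \<comment> \<open>The exponent -3/2 leaves a factor \<open>k powr (1/2)\<close> to absorb the
    squared logarithm and is still summable.\<close>
  have O: "(\<lambda>k. (1 + ln (real (Suc k)))\<^sup>2 / real (Suc k) ^ 2) \<in> O(\<lambda>k. real k powr (-3/2))"
    by real_asymp
  have "summable (\<lambda>k. (1 + ln (real (Suc k)))\<^sup>2 / real (Suc k) ^ 2)"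
    by (rule summable_comparison_test_bigo[OF _ O]) (simp add: summable_real_powr_iff)
  thus "summable (\<lambda>k. c k / real (Suc k) ^ 2)"
    by (rule summable_comparison_test') (use nonneg le in \<open>auto intro!: divide_right_mono\<close>)
  have "(\<lambda>k. (1 + ln (real (Suc k)))\<^sup>2 / real (Suc k)) \<longlonglongrightarrow> 0"
    by real_asymp
  thus "(\<lambda>k. c k / real (Suc k)) \<longlonglongrightarrow> 0"
    by (rule Lim_null_comparison[rotated]) (use nonneg le in \<open>auto intro!: divide_right_mono always_eventually\<close>)
qed

lemma one_weight: "summable (\<lambda>k. (1::real) / real (Suc k) ^ 2)"
  using inverse_squares_sums by (simp add: sums_iff add.commute)

lemma harm_weight:
  "summable (\<lambda>k. harm k / real (Suc k) ^ 2)" "(\<lambda>k. harm k / real (Suc k)) \<longlonglongrightarrow> 0"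
proof -
  have "harm k \<le> (1 + ln (real (Suc k)))\<^sup>2" for k
    using harm_le_1_plus_ln[of k] self_le_power[of "1 + ln (real (Suc k))" 2] by simp
  from weight_bounds[OF harm_nonneg this]
  show "summable (\<lambda>k. harm k / real (Suc k) ^ 2)" "(\<lambda>k. harm k / real (Suc k)) \<longlonglongrightarrow> 0" .
qed

lemma esym2_harm_weight:
  "summable (\<lambda>k. esym2_harm k / real (Suc k) ^ 2)" "(\<lambda>k. esym2_harm k / real (Suc k)) \<longlonglongrightarrow> 0"
proof -
  have "esym2_harm k \<le> (1 + ln (real (Suc k)))\<^sup>2" for k
    using esym2_harm_le[of k] power_mono[OF harm_le_1_plus_ln[of k] harm_nonneg, of 2] by linarith
  from weight_bounds[OF esym2_harm_nonneg this]
  show "summable (\<lambda>k. esym2_harm k / real (Suc k) ^ 2)" "(\<lambda>k. esym2_harm k / real (Suc k)) \<longlonglongrightarrow> 0" .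
qed

section \<open>Difference recursions and closed forms of the three pole sums\<close>

lemma pole_sum_one: "pole_sum (\<lambda>_. 1) a = Digamma (a + 1) + euler_mascheroni" if "-1 < a" for a
proof -
  \<comment> \<open>Partial fractions turn the pole sum into the defining series of
    \<open>Digamma\<close>. The range \<open>-1 < a\<close> gives a two-sided neighbourhood of 0, as
    the power series expansion requires.\<close>
  have "pole_sum (\<lambda>_. 1) a = (\<Sum>k. inverse (real (Suc k)) - inverse (a + 1 + real k))"
    unfolding pole_sum_def using that
    by (intro suminf_cong) (simp add: field_simps add_nonneg_eq_0_iff)
  thus ?thesis by (simp add: Digamma_def)
qed

text \<open>The forward difference of \<open>harm\<close> is \<open>1 / (k + 1)\<close> times the
  next lower weight, here 1, and the boundary term vanishes with \<open>harm 0\<close>. The same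
  mechanism lowers \<open>esym2_harm\<close> to \<open>harm\<close>.\<close>

lemma pole_sum_harm_plus_1:
  assumes "0 \<le> a"
  shows "pole_sum harm (a + 1) - pole_sum harm a = pole_sum (\<lambda>_. 1) (a + 1) / (a + 1)"
proof -
  have "pole_sum (\<lambda>_. 1) (a + 1) / (a + 1) =
          (\<Sum>k. 1 * (a + 1) / (real (Suc k) * (real (Suc k) + (a + 1))) / (a + 1))"
    unfolding pole_sum_def using assms one_weight
    by (intro suminf_divide[symmetric] summable_pole_sum) auto
  also have "\<dots> = (\<Sum>k. (harm (Suc k) - harm k) / (real (Suc k) + (a + 1)))"
    using assms by (intro suminf_cong) (simp add: harm_Suc divide_simps)
  finally show ?thesis
    using pole_sum_plus_1[OF harm_nonneg harm_weight assms] by (simp add: harm_expand)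
qed

lemma pole_sum_esym2_plus_1:
  assumes "0 \<le> a"
  shows "pole_sum esym2_harm (a + 1) - pole_sum esym2_harm a = pole_sum harm (a + 1) / (a + 1)"
proof -
  have "pole_sum harm (a + 1) / (a + 1) =
          (\<Sum>k. harm k * (a + 1) / (real (Suc k) * (real (Suc k) + (a + 1))) / (a + 1))"
    unfolding pole_sum_def using assms harm_weight
    by (intro suminf_divide[symmetric] summable_pole_sum) (auto simp: harm_nonneg)
  also have "\<dots> = (\<Sum>k. (esym2_harm (Suc k) - esym2_harm k) / (real (Suc k) + (a + 1)))"
    using assms by (intro suminf_cong) (simp add: esym2_harm_Suc divide_simps)
  finally show ?thesis
    using pole_sum_plus_1[OF esym2_harm_nonneg esym2_harm_weight assms] by simp
qed

lemma Digamma_gap_nonneg: "0 \<le> a \<Longrightarrow> 0 \<le> Digamma (a + 1) + (euler_mascheroni :: real)"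
  using Digamma_real_mono[of 1 "a + 1"] by simp

lemma Polygamma_1_antimono: "(0::real) < x \<Longrightarrow> x \<le> y \<Longrightarrow> Polygamma 1 y \<le> Polygamma 1 x"
  using Polygamma_real_strict_antimono[of x y 1] by (cases "x = y") auto

text \<open>For natural \<open>a\<close> the two polygamma expressions are the power sums p_1 and
  p_2 of 1, 1/2, ..., 1/a, and the claim is Newton's formula 2 h_2 = p_1^2 + p_2 for the complete
  homogeneous symmetric polynomial. Adjoining the variable 1/(a+1) to h_2 gives exactly the
  recursion of the pole sums; real \<open>a\<close> follows by monotonicity.\<close>

lemma pole_sum_harm:
  assumes a: "0 \<le> a"
  shows "2 * pole_sum harm a =
           (Digamma (a + 1) + euler_mascheroni)\<^sup>2 + (Polygamma 1 1 - Polygamma 1 (a + 1))"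
    (is "_ = ?R a")
proof (rule monotone_eq_if_differences_vanish[where f = "\<lambda>a. 2 * pole_sum harm a" and g = ?R, OF _ _ _ _ _ a])
  show "2 * pole_sum harm x \<le> 2 * pole_sum harm y" if "0 \<le> x" "x \<le> y" for x y
    using pole_sum_mono[OF harm_nonneg harm_weight(1) that] by simp
  show "?R x \<le> ?R y" if "0 \<le> x" "x \<le> y" for x y
    using that Digamma_gap_nonneg[of x]
    by (intro add_mono power_mono diff_mono Polygamma_1_antimono Digamma_real_mono order.refl) auto
  show "2 * pole_sum harm (x + 1) - 2 * pole_sum harm x = ?R (x + 1) - ?R x" if "0 \<le> x" for x
  proof -
    \<comment> \<open>The variable adjoined in passing from x to x + 1: p_1 grows by u and p_2 by
      u^2.\<close>
    define u where "u = 1 / (x + 1)"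
    have D: "Digamma (x + 1 + 1) = Digamma (x + 1) + u"
      using that Digamma_plus1[of "x + 1"] by (simp add: u_def)
    have P: "Polygamma 1 (x + 1 + 1) = Polygamma 1 (x + 1) - u\<^sup>2"
      using that Polygamma_plus1[of "x + 1" 1] by (simp add: u_def power2_eq_square)
    have "2 * pole_sum harm (x + 1) - 2 * pole_sum harm x = 2 * (pole_sum harm (x + 1) - pole_sum harm x)"
      by simp
    also have "\<dots> = 2 * (u * (Digamma (x + 1) + u + euler_mascheroni))"
      unfolding D[symmetric] using that by (subst pole_sum_harm_plus_1, simp, subst pole_sum_one) (auto simp: u_def)
    also have "\<dots> = ?R (x + 1) - ?R x" unfolding D P by (simp add: algebra_simps power2_eq_square)
    finally show ?thesis .
  qed
  have diff_eq: "2 * pole_sum harm (real n + 1) - 2 * pole_sum harm (real n) =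
      2 * (pole_sum (\<lambda>_. 1) (real n + 1) / (real n + 1))" for n
    using pole_sum_harm_plus_1[of "real n"] by linarith
  have "(\<lambda>n. 2 * (pole_sum (\<lambda>_. 1) (real n + 1) / (real n + 1))) \<longlonglongrightarrow> 2 * 0"
    by (intro tendsto_mult tendsto_const pole_sum_over_nat_tendsto_0 one_weight) auto
  thus "(\<lambda>n. 2 * pole_sum harm (real n + 1) - 2 * pole_sum harm (real n)) \<longlonglongrightarrow> 0"
    unfolding diff_eq by (simp only: mult_zero_right)
qed simp

text \<open>One degree higher: 6 h_3 = p_1^3 + 3 p_1 p_2 + 2 p_3, the difference of
  \<open>Polygamma 2\<close> being 2 p_3. The recursion expresses the unit difference through
  \<open>pole_sum_harm\<close> at x + 1.\<close>

lemma pole_sum_esym2_harm: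
  assumes a: "0 \<le> a"
  shows "6 * pole_sum esym2_harm a =
           (Digamma (a + 1) + euler_mascheroni) ^ 3
           + 3 * (Digamma (a + 1) + euler_mascheroni) * (Polygamma 1 1 - Polygamma 1 (a + 1))
           + (Polygamma 2 (a + 1) - Polygamma 2 1)"
    (is "_ = ?R a")
proof (rule monotone_eq_if_differences_vanish[where f = "\<lambda>a. 6 * pole_sum esym2_harm a" and g = ?R, OF _ _ _ _ _ a])
  show "6 * pole_sum esym2_harm x \<le> 6 * pole_sum esym2_harm y" if "0 \<le> x" "x \<le> y" for x y
    using pole_sum_mono[OF esym2_harm_nonneg esym2_harm_weight(1) that] by simp
  show "?R x \<le> ?R y" if "0 \<le> x" "x \<le> y" for x y
    using that Digamma_gap_nonneg[of x] Digamma_gap_nonneg[of y] Polygamma_1_antimono[of 1 "x + 1"]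
    by (intro add_mono power_mono diff_mono mult_mono Polygamma_1_antimono Polygamma_real_mono order.refl) auto
  show "6 * pole_sum esym2_harm (x + 1) - 6 * pole_sum esym2_harm x = ?R (x + 1) - ?R x" if "0 \<le> x" for x
  proof -
    define u where "u = 1 / (x + 1)"
    have D: "Digamma (x + 1 + 1) = Digamma (x + 1) + u"
      using that Digamma_plus1[of "x + 1"] by (simp add: u_def)
    have P: "Polygamma 1 (x + 1 + 1) = Polygamma 1 (x + 1) - u\<^sup>2"
      using that Polygamma_plus1[of "x + 1" 1] by (simp add: u_def power2_eq_square)
    have P2: "Polygamma 2 (x + 1 + 1) = Polygamma 2 (x + 1) + 2 * u ^ 3"
      using that Polygamma_plus1[of "x + 1" 2] by (simp add: u_def power_divide fact_2 power3_eq_cube power2_eq_square)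
    have "6 * pole_sum esym2_harm (x + 1) - 6 * pole_sum esym2_harm x
            = 3 * u * (2 * pole_sum harm (x + 1))"
      using pole_sum_esym2_plus_1[OF that] by (simp add: u_def algebra_simps)
    also have "2 * pole_sum harm (x + 1) =
        (Digamma (x + 1) + u + euler_mascheroni)\<^sup>2 + (Polygamma 1 1 - (Polygamma 1 (x + 1) - u\<^sup>2))"
      using pole_sum_harm[of "x + 1"] that unfolding D P by simp
    also have "3 * u * \<dots> = ?R (x + 1) - ?R x"
      unfolding D P P2 by (simp add: algebra_simps power2_eq_square power3_eq_cube)
    finally show ?thesis .
  qed
  have diff_eq: "6 * pole_sum esym2_harm (real n + 1) - 6 * pole_sum esym2_harm (real n) =
      6 * (pole_sum harm (real n + 1) / (real n + 1))" for n
    using pole_sum_esym2_plus_1[of "real n"] by linarith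
  have "(\<lambda>n. 6 * (pole_sum harm (real n + 1) / (real n + 1))) \<longlonglongrightarrow> 6 * 0"
    by (intro tendsto_mult tendsto_const pole_sum_over_nat_tendsto_0 harm_weight harm_nonneg)
  thus "(\<lambda>n. 6 * pole_sum esym2_harm (real n + 1) - 6 * pole_sum esym2_harm (real n)) \<longlonglongrightarrow> 0"
    unfolding diff_eq by (simp only: mult_zero_right)
qed simp

subsection \<open>Identities between generating series\<close>

text \<open>A nonzero F is X^d G with G(0) nonzero, so f has no zeros in a punctured neighbourhood.
  Vanishing on one side is therefore enough: the closed forms above are known for
  \<open>a = - x\<close> nonnegative only, and the reflection formula is used to the right of
  0.\<close>

lemma fps_eq_0_if_expansion_eq_0:
  fixes f :: "real \<Rightarrow> real"
  assumes f: "f has_fps_expansion F"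
    and zero: "eventually (\<lambda>x. f x = 0) (at 0 within S)" and "at 0 within S \<noteq> bot"
  shows "F = 0"
proof (rule ccontr)
  assume "F \<noteq> 0"
  define G where "G = fps_shift (subdegree F) F"
  have G: "F = G * fps_X ^ subdegree F" "fps_nth G 0 \<noteq> 0"
    using \<open>F \<noteq> 0\<close> by (auto simp: G_def subdegree_decompose[symmetric])
  have radius: "0 < fps_conv_radius G" using f by (simp add: G_def has_fps_expansion_def)
  have "isCont (eval_fps G) 0"
    using radius by (intro continuous_eval_fps) (simp add: zero_ereal_def)
  hence "eventually (\<lambda>x. eval_fps G x \<noteq> 0) (at 0)"
    using G(2) by (intro tendsto_imp_eventually_ne[of _ "eval_fps G 0"]) (auto simp: isCont_def eval_fps_at_0)
  moreover have "eventually (\<lambda>x. eval_fps F x = f x) (at 0)"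
    using f by (auto simp: has_fps_expansion_def eventually_at_filter elim: eventually_mono)
  moreover have "eventually (\<lambda>x. x \<in> eball 0 (fps_conv_radius G) - {0}) (at 0)"
    using radius by (intro eventually_at_in_open) (auto simp: zero_ereal_def)
  ultimately have "eventually (\<lambda>x. f x \<noteq> 0) (at 0)"
  proof eventually_elim
    case (elim x)
    have "eval_fps F x = eval_fps G x * x ^ subdegree F"
      using elim by (subst G(1), subst eval_fps_mult) auto
    with elim show ?case by auto
  qed
  hence "eventually (\<lambda>x. f x \<noteq> 0) (at 0 within S)"
    by (rule filter_leD[OF at_le[OF subset_UNIV]])
  with zero have "eventually (\<lambda>x. False) (at 0 within S)"
    by eventually_elim simp
  with \<open>at 0 within S \<noteq> bot\<close> show False by simp
qed

lemma has_fps_expansion_fps_deriv: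
  fixes f :: "real \<Rightarrow> real"
  assumes f: "f has_fps_expansion F"
    and f': "eventually (\<lambda>x. (f has_field_derivative f' x) (at x)) (nhds 0)"
  shows "f' has_fps_expansion fps_deriv F"
proof -
  have "deriv f has_fps_expansion fps_deriv F"
    by (rule has_fps_expansion_deriv[OF f])
  moreover have "eventually (\<lambda>x. deriv f x = f' x) (nhds 0)"
    using f' by eventually_elim (rule DERIV_imp_deriv)
  ultimately show ?thesis
    unfolding has_fps_expansion_def by (auto elim: eventually_elim2)
qed

lemma eventually_abs_less_1: "eventually (\<lambda>x :: real. \<bar>x\<bar> < 1) (nhds 0)"
  using eventually_nhds_ball[of 1 "0 :: real"] by (auto elim!: eventually_mono)

lemma pole_series_has_fps_expansion:
  fixes c :: "nat \<Rightarrow> real"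
  assumes "\<And>k. 0 \<le> c k" "summable (\<lambda>k. c k / real (Suc k) ^ 2)"
  shows "(\<lambda>x. - pole_sum c (- x)) has_fps_expansion pole_series c"
  using fps_conv_radius_pole_series[OF assms] eventually_abs_less_1
  unfolding has_fps_expansion_def
  by (auto elim!: eventually_mono simp: eval_pole_series[OF assms] intro: less_le_trans[of 0 "1 :: ereal"])

abbreviation zeta_series :: "real fps" where
  "zeta_series \<equiv> pole_series (\<lambda>_. 1)"

lemma zeta_series_expansion:
  "(\<lambda>x. - (Digamma (1 - x) + euler_mascheroni)) has_fps_expansion zeta_series"
proof -
  have "(\<lambda>x. - pole_sum (\<lambda>_. 1) (- x)) has_fps_expansion zeta_series"
    by (rule pole_series_has_fps_expansion) (use one_weight in auto)
  moreover have "eventually (\<lambda>x. - pole_sum (\<lambda>_. 1) (- x) = - (Digamma (1 - x) + euler_mascheroni)) (nhds 0)"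
    using eventually_abs_less_1 by eventually_elim (simp add: pole_sum_one)
  ultimately show ?thesis
    unfolding has_fps_expansion_def by (auto elim: eventually_elim2)
qed

lemma zeta_series_deriv_expansion:
  "(\<lambda>x. Polygamma 1 (1 - x)) has_fps_expansion fps_deriv zeta_series"
proof (rule has_fps_expansion_fps_deriv[OF zeta_series_expansion])
  show "eventually (\<lambda>x. ((\<lambda>x. - (Digamma (1 - x) + euler_mascheroni)) has_real_derivative
          Polygamma 1 (1 - x)) (at x)) (nhds 0)"
    using eventually_abs_less_1
    by eventually_elim (auto intro!: derivative_eq_intros elim!: nonpos_Ints_cases)
qed

lemma zeta_series_deriv2_expansion:
  "(\<lambda>x. - Polygamma 2 (1 - x)) has_fps_expansion fps_deriv (fps_deriv zeta_series)"
proof (rule has_fps_expansion_fps_deriv[OF zeta_series_deriv_expansion])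
  show "eventually (\<lambda>x. ((\<lambda>x. Polygamma 1 (1 - x)) has_real_derivative
          - Polygamma 2 (1 - x)) (at x)) (nhds 0)"
    using eventually_abs_less_1
    by eventually_elim (auto intro!: derivative_eq_intros elim!: nonpos_Ints_cases simp: numeral_2_eq_2)
qed

lemma eventually_at_left_0: "eventually (\<lambda>x :: real. -1 < x \<and> x < 0) (at_left 0)"
  using eventually_at_left_real[of "-1" 0] by (auto elim!: eventually_mono)

lemma harm_series_eq:
  "2 * pole_series harm =
     fps_deriv zeta_series - fps_const (Polygamma 1 1) - zeta_series ^ 2"
proof -
  have "(\<lambda>x. 2 * (- pole_sum harm (- x)) -
         (Polygamma 1 (1 - x) - Polygamma 1 1 - (- (Digamma (1 - x) + euler_mascheroni)) * (- (Digamma (1 - x) + euler_mascheroni))))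
        has_fps_expansion 2 * pole_series harm -
          (fps_deriv zeta_series - fps_const (Polygamma 1 1) - zeta_series * zeta_series)"
    by (intro has_fps_expansion_diff has_fps_expansion_mult has_fps_expansion_const has_fps_expansion_numeral
        pole_series_has_fps_expansion harm_nonneg harm_weight zeta_series_expansion zeta_series_deriv_expansion)
  hence "2 * pole_series harm -
          (fps_deriv zeta_series - fps_const (Polygamma 1 1) - zeta_series * zeta_series) = 0"
  proof (rule fps_eq_0_if_expansion_eq_0)
    show "eventually (\<lambda>x. 2 * (- pole_sum harm (- x)) -
         (Polygamma 1 (1 - x) - Polygamma 1 1 - (- (Digamma (1 - x) + euler_mascheroni)) * (- (Digamma (1 - x) + euler_mascheroni))) = 0)
         (at_left 0)"
      using eventually_at_left_0
    proof eventually_elim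
      case (elim x)
      thus ?case using pole_sum_harm[of "- x"] by (simp add: add.commute power2_eq_square algebra_simps)
    qed
  qed simp
  thus ?thesis by (simp add: power2_eq_square algebra_simps)
qed

lemma esym2_series_eq:
  "6 * pole_series esym2_harm =
     zeta_series ^ 3 + 3 * zeta_series * (fps_const (Polygamma 1 1) - fps_deriv zeta_series)
     + fps_deriv (fps_deriv zeta_series) + fps_const (Polygamma 2 1)"
  (is "_ = ?R")
proof -
  let ?h = "\<lambda>x :: real. - (Digamma (1 - x) + euler_mascheroni)"
  have "(\<lambda>x. 6 * (- pole_sum esym2_harm (- x)) -
         (?h x * ?h x * ?h x + 3 * ?h x * (Polygamma 1 1 - Polygamma 1 (1 - x)) + (- Polygamma 2 (1 - x)) + Polygamma 2 1))
        has_fps_expansion 6 * pole_series esym2_harm -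
         (zeta_series * zeta_series * zeta_series + 3 * zeta_series * (fps_const (Polygamma 1 1) - fps_deriv zeta_series)
     + fps_deriv (fps_deriv zeta_series) + fps_const (Polygamma 2 1))"
    by (intro has_fps_expansion_diff has_fps_expansion_add has_fps_expansion_mult has_fps_expansion_const has_fps_expansion_numeral
        pole_series_has_fps_expansion esym2_harm_nonneg esym2_harm_weight zeta_series_expansion
        zeta_series_deriv_expansion zeta_series_deriv2_expansion)
  hence "6 * pole_series esym2_harm -
         (zeta_series * zeta_series * zeta_series + 3 * zeta_series * (fps_const (Polygamma 1 1) - fps_deriv zeta_series)
     + fps_deriv (fps_deriv zeta_series) + fps_const (Polygamma 2 1)) = 0"
  proof (rule fps_eq_0_if_expansion_eq_0)
    show "eventually (\<lambda>x. 6 * (- pole_sum esym2_harm (- x)) -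
         (?h x * ?h x * ?h x + 3 * ?h x * (Polygamma 1 1 - Polygamma 1 (1 - x)) + (- Polygamma 2 (1 - x)) + Polygamma 2 1) = 0)
         (at_left 0)"
      using eventually_at_left_0
    proof eventually_elim
      case (elim x)
      thus ?case using pole_sum_esym2_harm[of "- x"] by (simp add: power3_eq_cube algebra_simps)
    qed
  qed simp
  thus ?thesis by (simp add: power3_eq_cube algebra_simps)
qed

section \<open>Even zeta values as odd-degree coefficients, reflection formulas and the Riccati
  equation\<close>

definition even_zeta_series :: "real fps" where
  "even_zeta_series = Abs_fps (\<lambda>n. if odd n then fps_nth zeta_series n else 0)"

text \<open>Half the difference of the zeta series at x and at -x; Euler's constant cancels.\<close>

lemma even_zeta_series_expansion:
  "(\<lambda>x. (Digamma (1 + x) - Digamma (1 - x)) / 2) has_fps_expansion even_zeta_series"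
proof -
  have sums: "(\<lambda>n. fps_nth even_zeta_series n * x ^ n) sums ((Digamma (1 + x) - Digamma (1 - x)) / 2)"
    if x: "\<bar>x\<bar> < 1" for x
  proof -
    have "(\<lambda>n. fps_nth zeta_series n * y ^ n) sums - (Digamma (1 - y) + euler_mascheroni)" if "\<bar>y\<bar> < 1" for y
      using pole_series_sums[OF _ one_weight that] pole_sum_one[of "- y"] that by simp
    from sums_divide[OF sums_diff[OF this[of x] this[of "- x"]], of 2]
    have "(\<lambda>n. (fps_nth zeta_series n * x ^ n - fps_nth zeta_series n * (- x) ^ n) / 2)
            sums ((Digamma (1 + x) - Digamma (1 - x)) / 2)"
      using x by (simp add: add.commute)
    thus ?thesis
      by (rule sums_cong[THEN iffD1, rotated]) (simp add: even_zeta_series_def)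
  qed
  have "1 \<le> fps_conv_radius even_zeta_series"
    unfolding fps_conv_radius_def
  proof (rule conv_radius_geI_ex)
    fix r :: real assume "0 < r" "ereal r < 1"
    thus "\<exists>z. norm z = r \<and> summable (\<lambda>n. fps_nth even_zeta_series n * z ^ n)"
      using sums[of r] by (intro exI[of _ r]) (auto simp: sums_iff)
  qed
  thus ?thesis
    using eventually_abs_less_1 unfolding has_fps_expansion_def
    by (auto elim!: eventually_mono simp: eval_fps_def sums[THEN sums_unique, symmetric]
             intro: less_le_trans[of 0 "1 :: ereal"])
qed

lemma even_zeta_series_deriv_expansion:
  "(\<lambda>x. (Polygamma 1 (1 + x) + Polygamma 1 (1 - x)) / 2) has_fps_expansion fps_deriv even_zeta_series"
proof (rule has_fps_expansion_fps_deriv[OF even_zeta_series_expansion])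
  show "eventually (\<lambda>x. ((\<lambda>x. (Digamma (1 + x) - Digamma (1 - x)) / 2) has_real_derivative
          (Polygamma 1 (1 + x) + Polygamma 1 (1 - x)) / 2) (at x)) (nhds 0)"
    using eventually_abs_less_1
    by eventually_elim (auto intro!: derivative_eq_intros elim!: nonpos_Ints_cases)
qed

lemma Gamma_reflection_real:
  assumes "0 < (x :: real)" "x < 1"
  shows "Gamma x * Gamma (1 - x) = pi / sin (pi * x)"
proof -
  have "of_real (Gamma x * Gamma (1 - x)) = (of_real (pi / sin (pi * x)) :: complex)"
    using Gamma_reflection_complex[of "of_real x"]
    by (simp add: Gamma_complex_of_real[symmetric] sin_of_real[symmetric])
  thus ?thesis by (simp only: of_real_eq_iff)
qed

lemma sin_pi_mult_pos: "0 < (x :: real) \<Longrightarrow> x < 1 \<Longrightarrow> 0 < sin (pi * x)"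
  by (rule sin_gt_zero) auto

text \<open>Logarithmic derivative of the reflection formula of \<open>Gamma\<close>.\<close>

lemma Digamma_reflection_real:
  assumes x: "0 < (x :: real)" "x < 1"
  shows "Digamma (1 - x) - Digamma x = pi * cot (pi * x)"
proof -
  have s: "0 < sin (pi * x)" using x by (rule sin_pi_mult_pos)
  have "((\<lambda>x. Gamma x * Gamma (1 - x)) has_real_derivative
          Gamma x * Gamma (1 - x) * (Digamma x - Digamma (1 - x))) (at x)"
    using x by (auto intro!: derivative_eq_intros elim!: nonpos_Ints_cases simp: algebra_simps)
  also have "?this \<longleftrightarrow> ((\<lambda>x. pi / sin (pi * x)) has_real_derivative
          Gamma x * Gamma (1 - x) * (Digamma x - Digamma (1 - x))) (at x)"
  proof (intro DERIV_cong_ev refl)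
    have "eventually (\<lambda>y. y \<in> {0<..<1}) (nhds x)"
      using x by (intro eventually_nhds_in_open) auto
    thus "eventually (\<lambda>x. Gamma x * Gamma (1 - x) = pi / sin (pi * x)) (nhds x)"
      by eventually_elim (simp add: Gamma_reflection_real)
  qed
  finally have "((\<lambda>x. pi / sin (pi * x)) has_real_derivative
          pi / sin (pi * x) * (Digamma x - Digamma (1 - x))) (at x)"
    using x by (simp add: Gamma_reflection_real)
  moreover have "((\<lambda>x. pi / sin (pi * x)) has_real_derivative
          pi / sin (pi * x) * (- pi * cot (pi * x))) (at x)"
    using s by (auto intro!: derivative_eq_intros simp: cot_def field_simps)
  ultimately have "pi / sin (pi * x) * (Digamma x - Digamma (1 - x)) = pi / sin (pi * x) * (- pi * cot (pi * x))"
    by (rule DERIV_unique)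
  hence "Digamma x - Digamma (1 - x) = - pi * cot (pi * x)"
    using s mult_left_cancel[of "pi / sin (pi * x)"] by (metis divide_eq_0_iff less_irrefl pi_neq_zero)
  thus ?thesis by simp
qed

text \<open>Differentiates the digamma reflection once more; writing 1/sin^2 as 1 + cot^2 leaves a
  polynomial in the cotangent.\<close>

lemma Polygamma_1_reflection_real:
  assumes x: "0 < (x :: real)" "x < 1"
  shows "Polygamma 1 (1 - x) + Polygamma 1 x = pi\<^sup>2 * (1 + (cot (pi * x))\<^sup>2)"
proof -
  have s: "0 < sin (pi * x)" using x by (rule sin_pi_mult_pos)
  have "((\<lambda>x. Digamma (1 - x) - Digamma x) has_real_derivative
          - (Polygamma 1 (1 - x) + Polygamma 1 x)) (at x)"
    using x by (auto intro!: derivative_eq_intros elim!: nonpos_Ints_cases)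
  also have "?this \<longleftrightarrow> ((\<lambda>x. pi * cot (pi * x)) has_real_derivative
          - (Polygamma 1 (1 - x) + Polygamma 1 x)) (at x)"
  proof (intro DERIV_cong_ev refl)
    have "eventually (\<lambda>y. y \<in> {0<..<1}) (nhds x)"
      using x by (intro eventually_nhds_in_open) auto
    thus "eventually (\<lambda>x. Digamma (1 - x) - Digamma x = pi * cot (pi * x)) (nhds x)"
      by eventually_elim (simp add: Digamma_reflection_real)
  qed
  finally have "((\<lambda>x. pi * cot (pi * x)) has_real_derivative
          - (Polygamma 1 (1 - x) + Polygamma 1 x)) (at x)" .
  moreover have "((\<lambda>x. pi * cot (pi * x)) has_real_derivative - (pi\<^sup>2 / (sin (pi * x))\<^sup>2)) (at x)"
  proof -
    have "((\<lambda>x. pi * x) has_real_derivative pi) (at x)"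
      by (auto intro!: derivative_eq_intros)
    from DERIV_cmult[OF DERIV_chain2[OF DERIV_cot this], of pi] s show ?thesis
      by (simp add: power2_eq_square divide_simps)
  qed
  ultimately have "- (Polygamma 1 (1 - x) + Polygamma 1 x) = - (pi\<^sup>2 / (sin (pi * x))\<^sup>2)"
    by (rule DERIV_unique)
  hence "Polygamma 1 (1 - x) + Polygamma 1 x = pi\<^sup>2 * (1 / (sin (pi * x))\<^sup>2)"
    by simp
  also have "1 / (sin (pi * x))\<^sup>2 = 1 + (cot (pi * x))\<^sup>2"
    using s sin_cos_squared_add[of "pi * x"] by (simp add: cot_def power_divide field_simps)
  finally show ?thesis .
qed

text \<open>On (0, 1) the series represents (1/x - pi cot(pi x))/2, and the equation is inherited
  from cot' = -1 - cot^2. The factor X clears the pole 1/x.\<close>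

lemma even_zeta_series_riccati:
  "2 * fps_X * even_zeta_series ^ 2 =
     fps_X * fps_deriv even_zeta_series + 2 * even_zeta_series - fps_const (pi\<^sup>2 / 2) * fps_X"
proof -
  let ?e = "\<lambda>x :: real. (Digamma (1 + x) - Digamma (1 - x)) / 2"
  let ?e' = "\<lambda>x :: real. (Polygamma 1 (1 + x) + Polygamma 1 (1 - x)) / 2"
  have "(\<lambda>x. 2 * x * (?e x * ?e x) - (x * ?e' x + 2 * ?e x - pi\<^sup>2 / 2 * x)) has_fps_expansion
     2 * fps_X * (even_zeta_series * even_zeta_series) -
     (fps_X * fps_deriv even_zeta_series + 2 * even_zeta_series - fps_const (pi\<^sup>2 / 2) * fps_X)"
    by (intro has_fps_expansion_diff has_fps_expansion_add has_fps_expansion_mult has_fps_expansion_const has_fps_expansion_numeral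
        has_fps_expansion_fps_X even_zeta_series_expansion even_zeta_series_deriv_expansion)
  hence "2 * fps_X * (even_zeta_series * even_zeta_series) -
     (fps_X * fps_deriv even_zeta_series + 2 * even_zeta_series - fps_const (pi\<^sup>2 / 2) * fps_X) = 0"
  proof (rule fps_eq_0_if_expansion_eq_0)
    show "eventually (\<lambda>x. 2 * x * (?e x * ?e x) - (x * ?e' x + 2 * ?e x - pi\<^sup>2 / 2 * x) = 0) (at_right 0)"
      using eventually_at_right_real[OF zero_less_one]
    proof eventually_elim
      case (elim x)
      hence x: "0 < x" "x < 1" by auto
      define C where "C = cot (pi * x)"
      have D: "Digamma (1 + x) = Digamma x + 1 / x"
        using x Digamma_plus1[of x] by (simp add: add.commute)
      have P: "Polygamma 1 (1 + x) = Polygamma 1 x - 1 / x\<^sup>2"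
        using x Polygamma_plus1[of x 1] by (simp add: add.commute power2_eq_square)
      \<comment> \<open>Reflection relates \<open>Digamma x\<close> to
        \<open>Digamma (1 - x)\<close>; moving from x to 1 + x contributes the 1/x.\<close>
      have e: "?e x = (1 / x - pi * C) / 2"
        using Digamma_reflection_real[OF x] by (simp add: D C_def)
      have e': "?e' x = (pi\<^sup>2 * (1 + C\<^sup>2) - 1 / x\<^sup>2) / 2"
        using Polygamma_1_reflection_real[OF x] unfolding P C_def by simp
      show ?case unfolding e e' using x by (simp add: field_simps power2_eq_square)
    qed
  qed simp
  thus ?thesis by (simp add: power2_eq_square algebra_simps)
qed

lemma Polygamma_1_1: "Polygamma 1 1 = pi\<^sup>2 / 6"
  using inverse_squares_sums by (simp add: Polygamma_def sums_iff numeral_2_eq_2 field_simps)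

subsection \<open>Multiple zeta values as coefficients\<close>

definition mzv_indices_le :: "nat \<Rightarrow> nat \<Rightarrow> nat list set" where
  "mzv_indices_le r N = {ms \<in> mzv_indices r. \<forall>n\<in>set ms. n \<le> N}"

definition mzv_term :: "nat list \<Rightarrow> nat list \<Rightarrow> real" where
  "mzv_term ks ms = (\<Prod>l<length ks. 1 / real (ms ! l) ^ (ks ! l))"

definition mzv_trunc :: "nat list \<Rightarrow> nat \<Rightarrow> real" where
  "mzv_trunc ks N = (\<Sum>ms\<in>mzv_indices_le (length ks) N. mzv_term ks ms)"

lemma mzv_indices_le_0: "mzv_indices_le 0 N = {[]}"
  by (auto simp: mzv_indices_le_def mzv_indices_def)

text \<open>Splits off the largest index, written \<open>Suc k\<close>, so that strict decrease
  bounds the remaining indices by k. The shift matches the denominators \<open>Suc k\<close> of the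
  pole sums.\<close>

lemma mzv_indices_Suc:
  "bij_betw (\<lambda>(k, ms). Suc k # ms) (Sigma UNIV (mzv_indices_le r)) (mzv_indices (Suc r))"
proof (rule bij_betwI[where g = "\<lambda>ms. (hd ms - 1, tl ms)"])
  show "(\<lambda>ms. (hd ms - 1, tl ms)) \<in> mzv_indices (Suc r) \<rightarrow> Sigma UNIV (mzv_indices_le r)"
    by (force simp: mzv_indices_def mzv_indices_le_def length_Suc_conv)
qed (auto simp: mzv_indices_def mzv_indices_le_def length_Suc_conv less_Suc_eq_le)

lemma mzv_indices_le_Suc:
  "bij_betw (\<lambda>(k, ms). Suc k # ms) (Sigma {..<N} (mzv_indices_le r)) (mzv_indices_le (Suc r) N)"
proof (rule bij_betwI[where g = "\<lambda>ms. (hd ms - 1, tl ms)"])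
  show "(\<lambda>ms. (hd ms - 1, tl ms)) \<in> mzv_indices_le (Suc r) N \<rightarrow> Sigma {..<N} (mzv_indices_le r)"
    by (force simp: mzv_indices_def mzv_indices_le_def length_Suc_conv)
qed (fastforce simp: mzv_indices_def mzv_indices_le_def length_Suc_conv less_Suc_eq_le)+

lemma finite_mzv_indices_le: "finite (mzv_indices_le r N)"
proof (induction r arbitrary: N)
  case (Suc r)
  have "finite (Sigma {..<N} (mzv_indices_le r))" using Suc by auto
  thus ?case using bij_betw_finite[OF mzv_indices_le_Suc[of N r]] by simp
qed (simp add: mzv_indices_le_0)

lemma mzv_term_nonneg: "0 \<le> mzv_term ks ms"
  by (simp add: mzv_term_def prod_nonneg)

lemma mzv_term_Cons: "mzv_term (s # ks) (Suc k # ms) = mzv_term ks ms / real (Suc k) ^ s"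
  by (simp add: mzv_term_def prod.lessThan_Suc_shift del: of_nat_Suc prod.lessThan_Suc)

lemma mzv_trunc_Nil: "mzv_trunc [] N = 1"
  by (simp add: mzv_trunc_def mzv_indices_le_0 mzv_term_def)

lemma mzv_trunc_Cons: "mzv_trunc (s # ks) N = (\<Sum>k<N. mzv_trunc ks k / real (Suc k) ^ s)"
proof -
  have "mzv_trunc (s # ks) N =
          (\<Sum>(k, ms)\<in>Sigma {..<N} (mzv_indices_le (length ks)). mzv_term (s # ks) (Suc k # ms))"
    unfolding mzv_trunc_def
    using sum.reindex_bij_betw[OF mzv_indices_le_Suc[of N "length ks"], of "mzv_term (s # ks)"]
    by (simp add: case_prod_unfold)
  also have "\<dots> = (\<Sum>k<N. \<Sum>ms\<in>mzv_indices_le (length ks) k. mzv_term (s # ks) (Suc k # ms))"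
    by (rule sum.Sigma[symmetric]) (auto intro: finite_mzv_indices_le)
  finally show ?thesis
    by (simp add: mzv_term_Cons mzv_trunc_def sum_divide_distrib)
qed

lemma mzv_trunc_1: "mzv_trunc [1] = harm"
  by (rule ext) (simp add: mzv_trunc_Cons mzv_trunc_Nil harm_altdef inverse_eq_divide)

lemma mzv_trunc_1_1: "mzv_trunc [1, 1] = esym2_harm"
  by (rule ext) (simp add: mzv_trunc_Cons[of _ "[_]"] mzv_trunc_1[unfolded One_nat_def] esym2_harm_def)

text \<open>All terms are nonnegative, so the unordered sum can be taken over the tail first and
  then over the leading index. The hypothesis guarantees convergence, so \<open>mzv\<close> is not
  the default value 0 of a divergent \<open>infsum\<close>.\<close>

lemma mzv_Cons:
  assumes "summable (\<lambda>k. mzv_trunc ks k / real (Suc k) ^ s)"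
  shows "mzv (s # ks) = (\<Sum>k. mzv_trunc ks k / real (Suc k) ^ s)"
proof -
  let ?f = "\<lambda>(k, ms). mzv_term (s # ks) (Suc k # ms)"
  have inner: "((\<lambda>ms. ?f (k, ms)) has_sum mzv_trunc ks k / real (Suc k) ^ s) (mzv_indices_le (length ks) k)" for k
    by (rule has_sum_finiteI)
       (simp_all add: finite_mzv_indices_le mzv_term_Cons mzv_trunc_def sum_divide_distrib)
  have outer: "((\<lambda>k. mzv_trunc ks k / real (Suc k) ^ s) has_sum (\<Sum>k. mzv_trunc ks k / real (Suc k) ^ s)) UNIV"
    using summable_sums[OF assms]
    by (rule sums_nonneg_imp_has_sum) (simp add: mzv_trunc_def sum_nonneg mzv_term_nonneg)
  have "(?f has_sum (\<Sum>k. mzv_trunc ks k / real (Suc k) ^ s)) (Sigma UNIV (mzv_indices_le (length ks)))"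
  proof (rule has_sum_SigmaI[OF inner outer])
    show "?f summable_on Sigma UNIV (mzv_indices_le (length ks))"
      by (rule summable_on_SigmaI[OF inner]) (use outer in \<open>auto simp: mzv_term_nonneg summable_on_def\<close>)
  qed
  hence "(mzv_term (s # ks) has_sum (\<Sum>k. mzv_trunc ks k / real (Suc k) ^ s)) (mzv_indices (Suc (length ks)))"
    using has_sum_reindex_bij_betw[OF mzv_indices_Suc[of "length ks"], of "mzv_term (s # ks)"]
    by (simp add: case_prod_unfold)
  thus ?thesis by (simp add: mzv_def mzv_term_def[abs_def] infsumI)
qed

lemma pole_series_nth:
  assumes nonneg: "\<And>k. 0 \<le> mzv_trunc ks k"
    and summable: "summable (\<lambda>k. mzv_trunc ks k / real (Suc k) ^ 2)" and n: "1 \<le> n"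
  shows "fps_nth (pole_series (mzv_trunc ks)) n = mzv ((n + 1) # ks)"
proof -
  have "summable (\<lambda>k. mzv_trunc ks k / real (Suc k) ^ (n + 1))"
  proof (rule summable_comparison_test'[OF summable])
    fix k :: nat
    show "norm (mzv_trunc ks k / real (Suc k) ^ (n + 1)) \<le> mzv_trunc ks k / real (Suc k) ^ 2"
      using nonneg[of k] n
      by (auto intro!: divide_left_mono power_increasing simp del: power_Suc of_nat_Suc)
  qed
  from mzv_Cons[OF this] show ?thesis using n by (simp add: pole_series_def)
qed

lemma
  assumes n: "1 \<le> n"
  shows zeta_series_nth: "fps_nth zeta_series n = mzv [n + 1]"
    and harm_series_nth: "fps_nth (pole_series harm) n = mzv [n + 1, 1]"
    and esym2_series_nth: "fps_nth (pole_series esym2_harm) n = mzv [n + 1, 1, 1]"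
proof -
  have Nil: "mzv_trunc [] = (\<lambda>_. 1)" by (rule ext) (rule mzv_trunc_Nil)
  show "fps_nth zeta_series n = mzv [n + 1]"
    using pole_series_nth[of "[]", unfolded Nil, OF _ one_weight n] by simp
  show "fps_nth (pole_series harm) n = mzv [n + 1, 1]"
    using pole_series_nth[of "[1]", unfolded mzv_trunc_1, OF harm_nonneg harm_weight(1) n] by simp
  show "fps_nth (pole_series esym2_harm) n = mzv [n + 1, 1, 1]"
    using pole_series_nth[of "[1, 1]", unfolded mzv_trunc_1_1, OF esym2_harm_nonneg esym2_harm_weight(1) n]
    by simp
qed

subsection \<open>Parity\<close>

text \<open>\<open>True\<close> stands for even and \<open>False\<close> for odd series; with this
  coding a product has parity \<open>p = q\<close>.\<close>

definition fps_parity :: "bool \<Rightarrow> real fps \<Rightarrow> bool" where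
  "fps_parity p F \<longleftrightarrow> (\<forall>n. even n \<noteq> p \<longrightarrow> fps_nth F n = 0)"

lemma fps_parity_nth: "fps_parity p F \<Longrightarrow> even n \<noteq> p \<Longrightarrow> fps_nth F n = 0"
  by (simp add: fps_parity_def)

lemma fps_parity_add: "fps_parity p F \<Longrightarrow> fps_parity p G \<Longrightarrow> fps_parity p (F + G)"
  and fps_parity_diff: "fps_parity p F \<Longrightarrow> fps_parity p G \<Longrightarrow> fps_parity p (F - G)"
  by (simp_all add: fps_parity_def)

lemma fps_parity_mult:
  assumes F: "fps_parity p F" and G: "fps_parity q G" and r: "r = (p = q)"
  shows "fps_parity r (F * G)"
  unfolding fps_parity_def fps_mult_nth
proof (intro allI impI sum.neutral ballI)
  fix n i :: nat
  assume n: "even n \<noteq> r" and i: "i \<in> {0..n}"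
  have "i + (n - i) = n" using i by simp
  with even_add[of i "n - i"] have "even n = (even i = even (n - i))" by (simp only:)
  with n r have "even i \<noteq> p \<or> even (n - i) \<noteq> q" by blast
  thus "fps_nth F i * fps_nth G (n - i) = 0"
    using fps_parity_nth[OF F] fps_parity_nth[OF G] by (elim disjE) simp_all
qed

lemma fps_parity_power2: "fps_parity p F \<Longrightarrow> fps_parity True (F ^ 2)"
  using fps_parity_mult[of p F p F True] by (simp add: power2_eq_square)

lemma fps_parity_deriv: "fps_parity p F \<Longrightarrow> r = (\<not> p) \<Longrightarrow> fps_parity r (fps_deriv F)"
  by (simp add: fps_parity_def)

lemma fps_parity_const: "fps_parity True (fps_const c)"
  by (auto simp: fps_parity_def)

lemma fps_parity_numeral: "fps_parity True (numeral k)"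
  by (simp add: fps_parity_const fps_numeral_fps_const)

lemma fps_parity_X: "fps_parity False fps_X"
  by (auto simp: fps_parity_def fps_X_def)

lemmas fps_parity_intros =
  fps_parity_add fps_parity_diff fps_parity_mult fps_parity_deriv
  fps_parity_power2 fps_parity_const fps_parity_numeral fps_parity_X

section \<open>Four coefficient identities from parity and the Riccati equation\<close>

text \<open>
  \<open>E\<close> carries the even zeta values and \<open>U\<close> the odd ones. The shift by one between argument and
  exponent makes \<open>E\<close> an odd and \<open>U\<close> an even series.
\<close>
locale zeta_relations =
  fixes P E U Q R :: "real fps" and z k :: real
  assumes parity_E: "fps_parity False E" and parity_U: "fps_parity True U"
    and P: "P = E + U"
    and Q: "2 * Q = fps_deriv P - fps_const z - P ^ 2"
    and R: "6 * R = P ^ 3 + 3 * P * (fps_const z - fps_deriv P) + fps_deriv (fps_deriv P) + fps_const k"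
    and riccati: "2 * fps_X * E ^ 2 = fps_X * fps_deriv E + 2 * E - 3 * fps_const z * fps_X"
begin

lemma Q_deriv: "2 * fps_deriv Q = fps_deriv (fps_deriv P) - 2 * P * fps_deriv P"
proof -
  have "fps_deriv (2 * Q) = 2 * fps_deriv Q" by simp
  thus ?thesis unfolding Q by (simp add: power2_eq_square algebra_simps)
qed

text \<open>Serves to eliminate the second derivative of E in
  \<open>relation_weight_plus_2_even\<close>.\<close>

lemma riccati_deriv:
  "2 * E ^ 2 + 4 * fps_X * E * fps_deriv E =
     3 * fps_deriv E + fps_X * fps_deriv (fps_deriv E) - 3 * fps_const z"
proof -
  have "fps_deriv (2 * fps_X * E ^ 2) = 2 * E ^ 2 + 4 * fps_X * E * fps_deriv E"
    by (simp add: power2_eq_square algebra_simps)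
  thus ?thesis unfolding riccati by (simp add: algebra_simps)
qed

text \<open>Inserting P = E + U, the terms in E alone reduce to \<open>3 z X\<close> by the Riccati
  equation, and all terms containing U are even. Only degree 1 is disturbed, whence
  \<open>2 \<le> m\<close>.\<close>

lemma relation_weight_plus_1_odd:
  assumes "odd m" "2 \<le> m"
  shows "fps_nth (fps_X * fps_deriv P + 2 * P - 2 * (fps_X * (P * E))) m = 0"
proof -
  have "fps_X * fps_deriv P + 2 * P - 2 * (fps_X * (P * E)) =
          (fps_X * fps_deriv U + 2 * U - 2 * (fps_X * (U * E))) + fps_const (3 * z) * fps_X
          + (fps_X * fps_deriv E + 2 * E - 3 * fps_const z * fps_X - 2 * fps_X * E ^ 2)"
    by (simp add: P algebra_simps power2_eq_square fps_const_mult[symmetric] fps_numeral_fps_const[symmetric] del: fps_const_mult)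
  also have "\<dots> = (fps_X * fps_deriv U + 2 * U - 2 * (fps_X * (U * E))) + fps_const (3 * z) * fps_X"
    by (simp add: riccati)
  finally have *: "fps_X * fps_deriv P + 2 * P - 2 * (fps_X * (P * E)) = \<dots>" .
  have "fps_parity True (fps_X * fps_deriv U + 2 * U - 2 * (fps_X * (U * E)))"
    by (rule fps_parity_intros parity_E parity_U refl | simp)+
  from fps_parity_nth[OF this, of m] assms show ?thesis
    unfolding * by (auto simp: fps_X_def)
qed

text \<open>Replacing Q cancels the derivative of P, and 2 P E - P^2 = E^2 - U^2 has no mixed term;
  the factor X makes the remainder odd.\<close>

lemma relation_weight_plus_1_even:
  assumes "even m"
  shows "fps_nth (2 * (fps_X * Q) - fps_X * fps_deriv P + 2 * (fps_X * (P * E))) m = 0"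
proof -
  have "2 * (fps_X * Q) - fps_X * fps_deriv P + 2 * (fps_X * (P * E)) =
          fps_X * (2 * Q) - fps_X * fps_deriv P + 2 * (fps_X * (P * E))"
    by (simp add: algebra_simps)
  also have "\<dots> = fps_X * (E ^ 2 - U ^ 2 - fps_const z)"
    unfolding Q by (simp add: P algebra_simps power2_eq_square)
  finally have *: "2 * (fps_X * Q) - fps_X * fps_deriv P + 2 * (fps_X * (P * E)) = \<dots>" .
  have "fps_parity False (fps_X * (E ^ 2 - U ^ 2 - fps_const z))"
    by (rule fps_parity_intros parity_E parity_U refl | simp)+
  from fps_parity_nth[OF this, of m] assms show ?thesis unfolding * by simp
qed

text \<open>The odd part of the series is 2 U times the difference of the two sides of the Riccati
  equation, hence 0; \<open>Ev\<close> is the even remainder. The coefficient is twice the second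
  relation of the theorem.\<close>

lemma relation_weight_plus_2_odd:
  assumes "odd m"
  shows "fps_nth (2 * (2 * Q + fps_X * fps_deriv Q) + 6 * (fps_const z * (fps_X * P))
           - (2 * fps_deriv P + fps_X * fps_deriv (fps_deriv P))
           + 2 * (fps_X * ((fps_deriv P - fps_const z) * E)) + 2 * (fps_X * (P * (P * E)))) m = 0"
    (is "fps_nth ?L m = 0")
proof -
  define Ev where "Ev = 4 * (fps_const z * (fps_X * E)) - 2 * fps_const z - 2 * E ^ 2 - 2 * U ^ 2
    - 2 * (fps_X * (U * fps_deriv U)) + 2 * (fps_X * ((E ^ 2 + U ^ 2) * E))"
  have "?L = 2 * (2 * Q) + fps_X * (2 * fps_deriv Q) + 6 * (fps_const z * (fps_X * P))
           - (2 * fps_deriv P + fps_X * fps_deriv (fps_deriv P))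
           + 2 * (fps_X * ((fps_deriv P - fps_const z) * E)) + 2 * (fps_X * (P * (P * E)))"
    by (simp add: algebra_simps)
  also have "\<dots> = Ev + 2 * U * (2 * fps_X * E ^ 2 - (fps_X * fps_deriv E + 2 * E - 3 * fps_const z * fps_X))"
    unfolding Q Q_deriv Ev_def by (simp add: P algebra_simps power2_eq_square)
  also have "\<dots> = Ev" by (simp add: riccati)
  finally have *: "?L = Ev" .
  have "fps_parity True Ev"
    unfolding Ev_def by (rule fps_parity_intros parity_E parity_U refl | simp)+
  from fps_parity_nth[OF this, of m] assms show ?thesis unfolding * by simp
qed

text \<open>The even part consists of multiples of the Riccati equation and of its derivative, up to
  the constant \<open>6 z\<close>, which is invisible from degree 2 on; \<open>Od\<close> is the odd
  remainder. The coefficient is six times the fourth relation.\<close>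

lemma relation_weight_plus_2_even:
  assumes "even m" "2 \<le> m"
  shows "fps_nth (12 * (fps_X * R) - 6 * (fps_X * fps_deriv Q) - 18 * (fps_const z * (fps_X * P))
           + 3 * (2 * fps_deriv P + fps_X * fps_deriv (fps_deriv P))
           - 6 * (fps_X * ((fps_deriv P - fps_const z) * E)) - 6 * (fps_X * (P * (P * E)))) m = 0"
    (is "fps_nth ?L m = 0")
proof -
  define Od where "Od = 2 * (fps_X * (U * U ^ 2)) - 6 * (fps_X * (U * E ^ 2)) - 12 * (fps_const z * (fps_X * U))
    + 2 * (fps_X * fps_deriv (fps_deriv U)) + 2 * (fps_const k * fps_X) + 6 * fps_deriv U
    - 6 * (fps_X * (E * fps_deriv U))"
  have "?L = 2 * (fps_X * (6 * R)) - 3 * (fps_X * (2 * fps_deriv Q)) - 18 * (fps_const z * (fps_X * P))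
           + 3 * (2 * fps_deriv P + fps_X * fps_deriv (fps_deriv P))
           - 6 * (fps_X * ((fps_deriv P - fps_const z) * E)) - 6 * (fps_X * (P * (P * E)))"
    by (simp add: algebra_simps)
  also have "\<dots> = Od + 6 * fps_const z
      - 2 * E * (2 * fps_X * E ^ 2 - (fps_X * fps_deriv E + 2 * E - 3 * fps_const z * fps_X))
      - 2 * (2 * E ^ 2 + 4 * fps_X * E * fps_deriv E -
          (3 * fps_deriv E + fps_X * fps_deriv (fps_deriv E) - 3 * fps_const z))"
    unfolding R Q_deriv Od_def by (simp add: P algebra_simps power2_eq_square power3_eq_cube)
  also have "\<dots> = Od + fps_const (6 * z)"
    unfolding riccati riccati_deriv by (simp add: fps_const_mult[symmetric] fps_numeral_fps_const[symmetric] del: fps_const_mult)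
  finally have *: "?L = \<dots>" .
  have "fps_parity False Od"
    unfolding Od_def by (rule fps_parity_intros parity_E parity_U refl | simp)+
  from fps_parity_nth[OF this, of m] assms show ?thesis unfolding * by simp
qed

end

section \<open>Coefficients of products as sums over pairs and triples\<close>

lemma fps_X_mult_mult_odd_nth:
  fixes F E :: "real fps"
  assumes F: "fps_nth F 0 = 0" and E: "fps_parity False E"
  shows "fps_nth (fps_X * (F * E)) m =
    (\<Sum>(i, k) \<in> {(i, k). 1 \<le> i \<and> 1 \<le> k \<and> i + 2 * k = m}. fps_nth F i * fps_nth E (2 * k - 1))"
proof (cases "m = 0")
  case False
  have "fps_nth (fps_X * (F * E)) m = (\<Sum>i = 0..m - 1. fps_nth F i * fps_nth E (m - 1 - i))"
    using False by (simp add: fps_mult_nth[of F E])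
  \<comment> \<open>The zero constant term of F excludes \<open>i = 0\<close>; oddness of E leaves
    only odd \<open>m - 1 - i\<close>.\<close>
  also have "\<dots> = (\<Sum>i\<in>{i. 1 \<le> i \<and> i < m \<and> even (m - i)}. fps_nth F i * fps_nth E (m - 1 - i))"
  proof (rule sum.mono_neutral_right)
    show "\<forall>i\<in>{0..m - 1} - {i. 1 \<le> i \<and> i < m \<and> even (m - i)}. fps_nth F i * fps_nth E (m - 1 - i) = 0"
    proof
      fix i assume i: "i \<in> {0..m - 1} - {i. 1 \<le> i \<and> i < m \<and> even (m - i)}"
      show "fps_nth F i * fps_nth E (m - 1 - i) = 0"
      proof (cases "i = 0")
        case False
        with i \<open>m \<noteq> 0\<close> have "even (m - 1 - i)" by auto
        thus ?thesis using fps_parity_nth[OF E] by simp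
      qed (simp add: F)
    qed
  qed (use False in auto)
  \<comment> \<open>The odd number \<open>m - 1 - i\<close> is written \<open>2 * k - 1\<close>; the
    factor X accounts for the 1 and makes the condition \<open>i + 2 * k = m\<close>.\<close>
  also have "\<dots> = (\<Sum>(i, k) \<in> {(i, k). 1 \<le> i \<and> 1 \<le> k \<and> i + 2 * k = m}. fps_nth F i * fps_nth E (2 * k - 1))"
    by (rule sum.reindex_bij_witness[of _ fst "\<lambda>i. (i, (m - i) div 2)"])
       (auto elim!: evenE simp: algebra_simps, presburger+)
  finally show ?thesis .
next
  case True
  hence "{(i, k). 1 \<le> i \<and> 1 \<le> k \<and> i + 2 * k = m} = {}" by auto
  with True show ?thesis by (simp only: sum.empty) simp
qed

lemma finite_pairs: "finite {(i :: nat, k). 1 \<le> i \<and> 1 \<le> k \<and> i + 2 * k = m}"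
  by (rule finite_subset[of _ "{..m} \<times> {..m}"]) auto

text \<open>Splits off one factor F and applies the pair formula to \<open>fps_X * (F * E)\<close>
  at degree \<open>m - i\<close>.\<close>

lemma fps_X_mult_mult_mult_odd_nth:
  fixes F E :: "real fps"
  assumes F: "fps_nth F 0 = 0" and E: "fps_parity False E"
  shows "fps_nth (fps_X * (F * (F * E))) m =
    (\<Sum>(i, j, k) \<in> {(i, j, k). 1 \<le> i \<and> 1 \<le> j \<and> 1 \<le> k \<and> i + j + 2 * k = m}.
       fps_nth F i * fps_nth F j * fps_nth E (2 * k - 1))"
proof -
  let ?S = "\<lambda>m. {(i :: nat, k). 1 \<le> i \<and> 1 \<le> k \<and> i + 2 * k = m}"
  have "fps_nth (fps_X * (F * (F * E))) m = fps_nth (F * (fps_X * (F * E))) m"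
    by (simp add: mult_ac)
  also have "\<dots> = (\<Sum>i = 0..m. fps_nth F i * fps_nth (fps_X * (F * E)) (m - i))"
    by (rule fps_mult_nth)
  also have "\<dots> = (\<Sum>i = 1..m. fps_nth F i * fps_nth (fps_X * (F * E)) (m - i))"
    by (rule sum.mono_neutral_right) (auto simp: F not_le)
  also have "\<dots> = (\<Sum>i = 1..m. \<Sum>(j, k) \<in> ?S (m - i). fps_nth F i * fps_nth F j * fps_nth E (2 * k - 1))"
    unfolding fps_X_mult_mult_odd_nth[OF assms]
    by (simp add: sum_distrib_left case_prod_unfold mult.assoc)
  also have "\<dots> = (\<Sum>(i, j, k) \<in> Sigma {1..m} (\<lambda>i. ?S (m - i)). fps_nth F i * fps_nth F j * fps_nth E (2 * k - 1))"
    by (subst sum.Sigma) (auto simp only: finite_pairs finite_atLeastAtMost)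
  also have "Sigma {1..m} (\<lambda>i. ?S (m - i)) = {(i, j, k). 1 \<le> i \<and> 1 \<le> j \<and> 1 \<le> k \<and> i + j + 2 * k = m}"
    by auto
  finally show ?thesis .
qed

text \<open>Coefficients of degree m in the four identities. At m = 1 the first relation would read
  3 zeta(2) = 0, and the second contains the divergent zeta(1). The triple sum is the coefficient of
  X P^2 E and so carries no factor i + 1, unlike in the English formulas; at m = 4 that factor would
  double its only term zeta(2)^3.\<close>

theorem corollary20:
  fixes m :: nat
  assumes "m \<ge> 2"
  shows
    "(odd m \<longrightarrow>
       real (m + 2) * mzv [m + 1] =
         2 * (\<Sum>(i, k) \<in> {(i, k). 1 \<le> i \<and> 1 \<le> k \<and> i + 2 * k = m}. mzv [i + 1] * mzv [2 * k]))
     \<and> (odd m \<longrightarrow>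
       real (m + 2) * mzv [m + 1, 1] =
         - (pi\<^sup>2 / 2) * mzv [m]
         + (real (m + 2) * real (m + 1) / 2) * mzv [m + 2]
         - (\<Sum>(i, k) \<in> {(i, k). 1 \<le> i \<and> 1 \<le> k \<and> i + 2 * k = m}.
              real (i + 1) * mzv [i + 2] * mzv [2 * k])
         - (\<Sum>(i, j, k) \<in> {(i, j, k). 1 \<le> i \<and> 1 \<le> j \<and> 1 \<le> k \<and> i + j + 2 * k = m}.
              mzv [i + 1] * mzv [j + 1] * mzv [2 * k]))
     \<and> (even m \<longrightarrow>
       2 * mzv [m, 1] =
         real m * mzv [m + 1]
         - 2 * (\<Sum>(i, k) \<in> {(i, k). 1 \<le> i \<and> 1 \<le> k \<and> i + 2 * k = m}. mzv [i + 1] * mzv [2 * k]))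
     \<and> (even m \<longrightarrow>
       2 * mzv [m, 1, 1] =
         real m * mzv [m + 1, 1]
         + (pi\<^sup>2 / 2) * mzv [m]
         - (real (m + 2) * real (m + 1) / 2) * mzv [m + 2]
         + (\<Sum>(i, k) \<in> {(i, k). 1 \<le> i \<and> 1 \<le> k \<and> i + 2 * k = m}.
              real (i + 1) * mzv [i + 2] * mzv [2 * k])
         + (\<Sum>(i, j, k) \<in> {(i, j, k). 1 \<le> i \<and> 1 \<le> j \<and> 1 \<le> k \<and> i + j + 2 * k = m}.
              mzv [i + 1] * mzv [j + 1] * mzv [2 * k]))"
proof -
  let ?P = zeta_series and ?E = even_zeta_series and ?Q = "pole_series harm" and ?R = "pole_series esym2_harm"
  let ?pairs = "{(i, k). 1 \<le> i \<and> 1 \<le> k \<and> i + 2 * k = m}"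
  let ?triples = "{(i, j, k). 1 \<le> i \<and> 1 \<le> j \<and> 1 \<le> k \<and> i + j + 2 * k = m}"
  have parity_E: "fps_parity False ?E"
    by (auto simp: fps_parity_def even_zeta_series_def)
  \<comment> \<open>Here z is zeta(2), so \<open>3 * z\<close> is the constant
    \<open>pi\<^sup>2 / 2\<close> of the Riccati equation.\<close>
  interpret zeta_relations ?P ?E "?P - ?E" ?Q ?R "pi\<^sup>2 / 6" "Polygamma 2 1"
  proof
    show "fps_parity True (?P - ?E)"
      by (auto simp: fps_parity_def even_zeta_series_def)
    show "2 * fps_X * ?E ^ 2 = fps_X * fps_deriv ?E + 2 * ?E - 3 * fps_const (pi\<^sup>2 / 6) * fps_X"
      unfolding even_zeta_series_riccati by (simp add: fps_numeral_fps_const)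
    show "2 * ?Q = fps_deriv ?P - fps_const (pi\<^sup>2 / 6) - ?P ^ 2"
      unfolding Polygamma_1_1[symmetric] by (rule harm_series_eq)
    show "6 * ?R = ?P ^ 3 + 3 * ?P * (fps_const (pi\<^sup>2 / 6) - fps_deriv ?P)
        + fps_deriv (fps_deriv ?P) + fps_const (Polygamma 2 1)"
      unfolding Polygamma_1_1[symmetric] by (rule esym2_series_eq)
  qed (simp_all add: parity_E)

  have P0: "fps_nth ?P 0 = 0" by (simp add: pole_series_def)
  have P: "fps_nth ?P i = mzv [i + 1]" if "1 \<le> i" for i
    using that by (rule zeta_series_nth)
  have E: "fps_nth ?E (2 * k - 1) = mzv [2 * k]" if "1 \<le> k" for k
    using that P[of "2 * k - 1"] by (simp add: even_zeta_series_def)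
  \<comment> \<open>The constant term of the derivative of P is zeta(2). Subtracting it yields the
    zero constant term that the pair formula needs, so its sum starts at
    \<open>i = 1\<close>.\<close>
  have deriv_P0: "fps_nth (fps_deriv ?P - fps_const (pi\<^sup>2 / 6)) 0 = 0"
  proof -
    have "(\<Sum>k. 1 / real (Suc k) ^ 2) = pi\<^sup>2 / 6"
      using inverse_squares_sums by (simp add: sums_iff add.commute)
    thus ?thesis by (simp add: pole_series_def fps_deriv_nth numeral_2_eq_2 del: of_nat_Suc)
  qed
  have PE: "fps_nth (fps_X * (?P * ?E)) m = (\<Sum>(i, k) \<in> ?pairs. mzv [i + 1] * mzv [2 * k])"
    unfolding fps_X_mult_mult_odd_nth[OF P0 parity_E] by (rule sum.cong) (auto simp: P E[unfolded One_nat_def])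
  have PPE: "fps_nth (fps_X * (?P * (?P * ?E))) m =
      (\<Sum>(i, j, k) \<in> ?triples. mzv [i + 1] * mzv [j + 1] * mzv [2 * k])"
    unfolding fps_X_mult_mult_mult_odd_nth[OF P0 parity_E] by (rule sum.cong) (auto simp: P E[unfolded One_nat_def])
  have P'E: "fps_nth (fps_X * ((fps_deriv ?P - fps_const (pi\<^sup>2 / 6)) * ?E)) m =
      (\<Sum>(i, k) \<in> ?pairs. real (i + 1) * mzv [i + 2] * mzv [2 * k])"
    unfolding fps_X_mult_mult_odd_nth[OF deriv_P0 parity_E]
    by (rule sum.cong) (auto simp: P E[unfolded One_nat_def] fps_deriv_nth)
  \<comment> \<open>Multiplication by X moves to degree n, and coefficients are zeta values only
    from degree 1 on.\<close>
  obtain n where m: "m = Suc n" "1 \<le> n" using assms by (cases m) auto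
  have Pm: "fps_nth ?P m = mzv [m + 1]" and XP: "fps_nth (fps_X * ?P) m = mzv [m]"
    and P': "fps_nth (fps_deriv ?P) m = real (m + 1) * mzv [m + 2]"
    and XP': "fps_nth (fps_X * fps_deriv ?P) m = real m * mzv [m + 1]"
    and XP'': "fps_nth (fps_X * fps_deriv (fps_deriv ?P)) m = real m * (real (m + 1) * mzv [m + 2])"
    using m by (simp_all add: P)
  have Qm: "fps_nth ?Q m = mzv [m + 1, 1]" and XQ: "fps_nth (fps_X * ?Q) m = mzv [m, 1]"
    and XQ': "fps_nth (fps_X * fps_deriv ?Q) m = real m * mzv [m + 1, 1]"
    using m by (simp_all add: harm_series_nth)
  have XR: "fps_nth (fps_X * ?R) m = mzv [m, 1, 1]"
    using m by (simp add: esym2_series_nth)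
  have numeral_nth: "fps_nth (numeral b * F) m = numeral b * fps_nth F m" for b and F :: "real fps"
    by (simp add: fps_numeral_fps_const)
  note nth = fps_add_nth fps_sub_nth numeral_nth fps_mult_left_const_nth
    Pm XP P' XP' XP'' Qm XQ XQ' XR PE PPE P'E
  show ?thesis
  proof (intro conjI impI)
    assume odd: "odd m"
    show "real (m + 2) * mzv [m + 1] = 2 * (\<Sum>(i, k) \<in> ?pairs. mzv [i + 1] * mzv [2 * k])"
      using relation_weight_plus_1_odd[OF odd assms] unfolding nth by (simp add: algebra_simps)
    show "real (m + 2) * mzv [m + 1, 1] = - (pi\<^sup>2 / 2) * mzv [m]
         + (real (m + 2) * real (m + 1) / 2) * mzv [m + 2]
         - (\<Sum>(i, k) \<in> ?pairs. real (i + 1) * mzv [i + 2] * mzv [2 * k])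
         - (\<Sum>(i, j, k) \<in> ?triples. mzv [i + 1] * mzv [j + 1] * mzv [2 * k])"
      using relation_weight_plus_2_odd[OF odd] unfolding nth by (simp add: algebra_simps)
  next
    assume even: "even m"
    show "2 * mzv [m, 1] = real m * mzv [m + 1]
         - 2 * (\<Sum>(i, k) \<in> ?pairs. mzv [i + 1] * mzv [2 * k])"
      using relation_weight_plus_1_even[OF even] unfolding nth by (simp add: algebra_simps)
    show "2 * mzv [m, 1, 1] = real m * mzv [m + 1, 1] + (pi\<^sup>2 / 2) * mzv [m]
         - (real (m + 2) * real (m + 1) / 2) * mzv [m + 2]
         + (\<Sum>(i, k) \<in> ?pairs. real (i + 1) * mzv [i + 2] * mzv [2 * k])
         + (\<Sum>(i, j, k) \<in> ?triples. mzv [i + 1] * mzv [j + 1] * mzv [2 * k])"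
    proof -
      have "(real (m + 2) * real (m + 1) / 2) * mzv [m + 2] =
          (2 * (real (m + 1) * mzv [m + 2]) + real m * (real (m + 1) * mzv [m + 2])) / 2"
        by (simp add: algebra_simps)
      with relation_weight_plus_2_even[OF even assms, unfolded nth] show ?thesis
        by linarith
    qed
  qed
qed

end
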